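(* Let $l,m$ be positive integers, let $\phi:\mathbb{N}\to(0,1)$ be non-increasing, and let $\bm{M}\in\mathbb{R}^{l\times m}$ satisfy $\prod_{u=1}^l\|\bm{j}\cdot\mathrm{row}_u(\bm{M})\|\ge\phi(|\bm{j}|)$ for all $\bm{j}\in\mathbb{Z}^m\setminus\{\bm{0}\}$. Then for every positive integer $J$, $$\sum_{\substack{\bm{j}\in\mathbb{Z}^m\setminus\{\bm{0}\}\\|\bm{j}|\le J}}\prod_{u=1}^l\|\bm{j}\cdot\mathrm{row}_u(\bm{M})\|^{-1}\le\frac{4^l}{\phi(2J)}\binom{l+\lfloor\log_2\frac{1}{\phi(J)}\rfloor}{l}.$$
   Context: $\mathrm{row}_u(\bm{M})$ denotes the $u$-th row of $\bm{M}$, $\|y\|$ is the distance from $y\in\mathbb{R}$ to the nearest integer, and $|\bm{j}|$ is the supremum norm. *)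

theory Defs
  imports "HOL-Analysis.Analysis"
begin

definition dist_nearest_int :: "real \<Rightarrow> real" where
  "dist_nearest_int y = \<bar>y - of_int (round y)\<bar>"

definition int_sup_norm :: "int ^ 'n \<Rightarrow> nat" where
  "int_sup_norm j = Max (range (\<lambda>i. nat \<bar>j $ i\<bar>))"

definition real_vec :: "int ^ 'n \<Rightarrow> real ^ 'n" where
  "real_vec j = (\<chi> i. of_int (j $ i))"

end

theory Submission
  imports Defs
begin

text \<open>
  Sort the points \<open>j\<close> by the signs of the residues \<open>s\<^sub>u\<close> of \<open>j \<cdot> row\<^sub>u\<close> modulo 1 in \<open>[-1/2, 1/2]\<close>
  and by the exponents with \<open>2\<^bsup>-k\<^sub>u-1\<^esup> < \<bar>s\<^sub>u\<bar> \<le> 2\<^bsup>-k\<^sub>u\<^esup>\<close>.  The hypothesis at \<open>j\<close> forces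
  \<open>\<Sum> k\<^sub>u \<le> log\<^sub>2 (1/\<phi>(J))\<close>, which leaves at most \<open>2\<^sup>l\<close> times the binomial coefficient many cells.
  Two points of one cell differ by a nonzero vector of norm at most \<open>2J\<close>, so the hypothesis at the
  difference separates them: slicing the cell, a box of volume \<open>V\<close>, along one coordinate shows
  that it contains at most \<open>max 1 (2V/\<phi>(2J))\<close> points.  Every summand being at most \<open>1/V\<close>, the
  cell contributes at most \<open>2\<^sup>l/\<phi>(2J)\<close>.
\<close>

section \<open>Counting exponent vectors and separated reals\<close>

lemma finite_card_functions_sum_le:
  fixes A :: "'a set"
  assumes "finite A"
  shows "finite {k :: 'a \<Rightarrow> nat. (\<forall>x. x \<notin> A \<longrightarrow> k x = 0) \<and> sum k A \<le> n} \<and>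
    card {k :: 'a \<Rightarrow> nat. (\<forall>x. x \<notin> A \<longrightarrow> k x = 0) \<and> sum k A \<le> n} \<le> (card A + n) choose card A"
  using assms
proof (induction A arbitrary: n rule: finite_induct)
  case empty
  have "{k :: 'a \<Rightarrow> nat. \<forall>x. k x = 0} = {\<lambda>_. 0}" by auto
  then show ?case by simp
next
  case (insert a A)
  define F where "F n = {k :: 'a \<Rightarrow> nat. (\<forall>x. x \<notin> A \<longrightarrow> k x = 0) \<and> sum k A \<le> n}" for n
  let ?G = "{k :: 'a \<Rightarrow> nat. (\<forall>x. x \<notin> insert a A \<longrightarrow> k x = 0) \<and> sum k (insert a A) \<le> n}"
  have IH: "finite (F n)" "card (F n) \<le> (card A + n) choose card A" for n
    using insert.IH[of n] unfolding F_def by auto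
  \<comment> \<open>The index \<open>i = n - k a\<close> is the budget that the value at
    \<open>a\<close> leaves for \<open>A\<close>. Indexing by it rather than by \<open>k a\<close>
    turns the inductive bounds into a hockey-stick sum.\<close>
  have sub: "?G \<subseteq> (\<Union>i\<le>n. (\<lambda>k. k(a := n - i)) ` F i)"
  proof
    fix k assume k: "k \<in> ?G"
    then have s: "k a + sum k A \<le> n" using insert.hyps by simp
    have "sum (k(a := 0)) A = sum k A"
      using insert.hyps by (intro sum.cong) auto
    then have "k(a := 0) \<in> F (n - k a)" using k s by (auto simp: F_def)
    moreover have "k = (k(a := 0))(a := n - (n - k a))" using s by auto
    ultimately show "k \<in> (\<Union>i\<le>n. (\<lambda>k. k(a := n - i)) ` F i)"
      by (intro UN_I[of "n - k a"] image_eqI) auto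
  qed
  have fin: "finite (\<Union>i\<le>n. (\<lambda>k. k(a := n - i)) ` F i)" using IH by auto
  have "card ?G \<le> card (\<Union>i\<le>n. (\<lambda>k. k(a := n - i)) ` F i)"
    by (rule card_mono[OF fin sub])
  also have "\<dots> \<le> (\<Sum>i\<le>n. card ((\<lambda>k. k(a := n - i)) ` F i))"
    by (rule card_UN_le) simp
  also have "\<dots> \<le> (\<Sum>i\<le>n. (card A + i) choose card A)"
    by (intro sum_mono order_trans[OF card_image_le IH(2)] IH(1))
  \<comment> \<open>Passing to the complementary lower index gives the form in which the
    hockey-stick identity is stated.\<close>
  also have "\<dots> = (\<Sum>i\<le>n. (card A + i) choose i)"
    by (intro sum.cong refl) (simp add: binomial_symmetric[of "card A"])
  also have "\<dots> = Suc (card A + n) choose n"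
    by (rule sum_choose_lower)
  also have "\<dots> = (card (insert a A) + n) choose card (insert a A)"
    using insert.hyps binomial_symmetric[of n "Suc (card A + n)"] by simp
  finally show ?case using finite_subset[OF sub fin] by blast
qed

text \<open>Cut the interval into half-open pieces of length \<open>\<epsilon>\<close>; each holds
  at most one value. Measuring from the closed end \<open>b\<close> keeps the quotient strictly
  below \<open>(b - a) / \<epsilon>\<close>, so its ceiling counts the pieces.\<close>

lemma card_separated_le:
  fixes f :: "'a \<Rightarrow> real"
  assumes range: "\<And>x. x \<in> A \<Longrightarrow> a < f x \<and> f x \<le> b"
    and sep: "\<And>x y. x \<in> A \<Longrightarrow> y \<in> A \<Longrightarrow> x \<noteq> y \<Longrightarrow> \<epsilon> \<le> \<bar>f x - f y\<bar>"
    and \<epsilon>: "0 < \<epsilon>"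
  shows "real (card A) \<le> max 1 (2 * (b - a) / \<epsilon>)"
proof -
  define g where "g x = nat \<lfloor>(b - f x) / \<epsilon>\<rfloor>" for x
  have nonneg: "0 \<le> (b - f x) / \<epsilon>" if "x \<in> A" for x
    using range[OF that] \<epsilon> by simp
  have inj: "inj_on g A"
  proof (rule inj_onI, rule ccontr)
    fix x y assume xy: "x \<in> A" "y \<in> A" "g x = g y" "x \<noteq> y"
    then have "\<lfloor>(b - f x) / \<epsilon>\<rfloor> = \<lfloor>(b - f y) / \<epsilon>\<rfloor>"
      using nonneg[OF xy(1)] nonneg[OF xy(2)] by (simp add: g_def eq_nat_nat_iff)
    then have "\<bar>(b - f x) / \<epsilon> - (b - f y) / \<epsilon>\<bar> < 1" by linarith
    moreover have "(b - f x) / \<epsilon> - (b - f y) / \<epsilon> = (f y - f x) / \<epsilon>"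
      by (simp add: diff_divide_distrib)
    ultimately have "\<bar>f x - f y\<bar> < \<epsilon>" using \<epsilon> by (simp add: abs_divide abs_minus_commute)
    then show False using sep xy by fastforce
  qed
  have "g ` A \<subseteq> {..<nat \<lceil>(b - a) / \<epsilon>\<rceil>}"
  proof
    fix y assume "y \<in> g ` A"
    then obtain x where x: "x \<in> A" "y = g x" by auto
    have "(b - f x) / \<epsilon> < (b - a) / \<epsilon>"
      using range[OF x(1)] \<epsilon> by (simp add: divide_strict_right_mono)
    then show "y \<in> {..<nat \<lceil>(b - a) / \<epsilon>\<rceil>}"
      using nonneg[OF x(1)] unfolding x g_def lessThan_iff by linarith
  qed
  then have "card A \<le> nat \<lceil>(b - a) / \<epsilon>\<rceil>"
    using card_inj_on_le[OF inj _ finite_lessThan] by (metis card_lessThan)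
  \<comment> \<open>For \<open>t > 1\<close> the ceiling is below \<open>t + 1 < 2 * t\<close>; this
    is the source of the factor 2.\<close>
  moreover have "real (nat \<lceil>t\<rceil>) \<le> max 1 (2 * t)" for t :: real
  proof (cases "t \<le> 1")
    case True
    then have "\<lceil>t\<rceil> \<le> 1" by (simp add: ceiling_le_iff)
    then show ?thesis by linarith
  next
    case False
    then show ?thesis by linarith
  qed
  from this[of "(b - a) / \<epsilon>"] have "real (nat \<lceil>(b - a) / \<epsilon>\<rceil>) \<le> max 1 (2 * (b - a) / \<epsilon>)"
    by simp
  ultimately show ?thesis by linarith
qed

section \<open>Dyadic cells and their contributions\<close>

lemma dyadic_bounds:
  fixes x :: real
  assumes "0 < x" "x \<le> 1"
  defines "k \<equiv> nat \<lfloor>log 2 (1 / x)\<rfloor>"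
  shows "(1/2) ^ Suc k < x" "x \<le> (1/2) ^ k"
proof -
  \<comment> \<open>Nonnegativity ensures that \<open>nat\<close> does not alter the floor.\<close>
  have nn: "0 \<le> log 2 (1 / x)" using assms by simp
  have "real k \<le> log 2 (1 / x)" "log 2 (1 / x) < real (Suc k)"
    using nn unfolding k_def by linarith+
  then have "2 powr real k \<le> 1 / x" "1 / x < 2 powr real (Suc k)"
    using assms(1) by (simp_all add: le_log_iff log_less_iff)
  then have "2 ^ k \<le> 1 / x" "1 / x < 2 ^ Suc k"
    by (simp_all only: powr_realpow zero_less_numeral)
  then show "(1/2) ^ Suc k < x" "x \<le> (1/2) ^ k"
    using assms(1) by (simp_all add: field_simps)
qed

text \<open>A dyadic range is as long as its lower end, so the volume \<open>V\<close> of the box is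
  also the product of the lower bounds for the coordinates. Hence \<open>1 / V\<close> bounds each
  summand and cancels the volume in the count of points.\<close>

lemma sum_inverse_prod_cell_le:
  fixes s :: "'a \<Rightarrow> 'l::finite \<Rightarrow> real" and k :: "'l \<Rightarrow> nat"
  assumes cell: "\<And>j u. j \<in> A \<Longrightarrow> (1/2) ^ Suc (k u) < \<bar>s j u\<bar> \<and> \<bar>s j u\<bar> \<le> (1/2) ^ k u"
    and sign: "\<And>j i u. j \<in> A \<Longrightarrow> i \<in> A \<Longrightarrow> s j u < 0 \<longleftrightarrow> s i u < 0"
    and low: "\<And>j. j \<in> A \<Longrightarrow> \<delta> \<le> (\<Prod>u\<in>UNIV. \<bar>s j u\<bar>)"
    and sep: "\<And>j i. j \<in> A \<Longrightarrow> i \<in> A \<Longrightarrow> j \<noteq> i \<Longrightarrow> \<delta> \<le> (\<Prod>u\<in>UNIV. \<bar>s j u - s i u\<bar>)"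
    and \<delta>: "0 < \<delta>"
  shows "(\<Sum>j\<in>A. \<Prod>u\<in>UNIV. inverse \<bar>s j u\<bar>) \<le> 2 ^ CARD('l) / \<delta>"
proof (cases "A = {}")
  case True
  then show ?thesis using \<delta> by simp
next
  case False
  then obtain j0 where j0: "j0 \<in> A" by auto
  \<comment> \<open>The slicing direction \<open>v\<close> is arbitrary. \<open>V\<close> is the
    volume of the box and \<open>W\<close> that of its face orthogonal to \<open>v\<close>.\<close>
  fix v :: 'l
  define V where "V = (\<Prod>u\<in>UNIV. (1/2 :: real) ^ Suc (k u))"
  define W where "W = (\<Prod>u\<in>UNIV - {v}. (1/2 :: real) ^ Suc (k u))"
  have pos: "0 < V" "0 < W" by (simp_all add: V_def W_def prod_pos)
  have V_W: "V = (1/2) ^ Suc (k v) * W"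
    unfolding V_def W_def by (rule prod.remove) auto
  have side: "\<bar>s j u - s i u\<bar> \<le> (1/2) ^ Suc (k u)" if "j \<in> A" "i \<in> A" for j i u
    using cell[OF that(1), of u] cell[OF that(2), of u] sign[OF that, of u]
    by (auto simp: abs_if split: if_splits)
  have sep_v: "\<delta> / W \<le> \<bar>\<bar>s j v\<bar> - \<bar>s i v\<bar>\<bar>" if ij: "j \<in> A" "i \<in> A" "j \<noteq> i" for j i
  proof -
    have "\<delta> \<le> (\<Prod>u\<in>UNIV. \<bar>s j u - s i u\<bar>)" by (rule sep[OF ij])
    also have "\<dots> = \<bar>s j v - s i v\<bar> * (\<Prod>u\<in>UNIV - {v}. \<bar>s j u - s i u\<bar>)"
      by (rule prod.remove) auto
    \<comment> \<open>The remaining coordinates contribute at most the face volume, so the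
      separation of the product becomes a gap \<open>\<delta> / W\<close> along
      \<open>v\<close>.\<close>
    also have "\<dots> \<le> \<bar>s j v - s i v\<bar> * W"
      unfolding W_def using side[OF ij(1,2)] by (intro mult_left_mono prod_mono) auto
    finally have "\<delta> / W \<le> \<bar>s j v - s i v\<bar>" using pos by (simp add: field_simps)
    also have "\<dots> = \<bar>\<bar>s j v\<bar> - \<bar>s i v\<bar>\<bar>" using sign[OF ij(1,2), of v] by auto
    finally show ?thesis .
  qed
  have "real (card A) \<le> max 1 (2 * ((1/2) ^ k v - (1/2) ^ Suc (k v)) / (\<delta> / W))"
    by (rule card_separated_le[where f = "\<lambda>j. \<bar>s j v\<bar>"]) (use cell sep_v \<delta> pos in auto)
  also have "\<dots> = max 1 (2 * V / \<delta>)" by (simp add: V_W)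
  finally have card: "real (card A) \<le> max 1 (2 * V / \<delta>)" .
  have summand: "(\<Prod>u\<in>UNIV. inverse \<bar>s j u\<bar>) \<le> inverse V" if "j \<in> A" for j
  proof -
    have "V \<le> (\<Prod>u\<in>UNIV. \<bar>s j u\<bar>)"
      unfolding V_def using cell[OF that] by (intro prod_mono) (auto simp: less_imp_le)
    then have "inverse (\<Prod>u\<in>UNIV. \<bar>s j u\<bar>) \<le> inverse V"
      using pos by (intro le_imp_inverse_le) auto
    then show ?thesis using prod_inversef[of "\<lambda>u. \<bar>s j u\<bar>" UNIV] by (simp add: comp_def)
  qed
  \<comment> \<open>The separation says nothing about a cell with one point. There the lower bound
    at that point keeps \<open>V\<close> from being too small: each upper bound is twice a side,
    whence \<open>2 ^ CARD('l)\<close>.\<close>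
  have "\<delta> \<le> (\<Prod>u\<in>UNIV. \<bar>s j0 u\<bar>)" by (rule low[OF j0])
  also have "\<dots> \<le> (\<Prod>u\<in>UNIV. 2 * (1/2) ^ Suc (k u))"
    using cell[OF j0] by (intro prod_mono) auto
  also have "\<dots> = 2 ^ CARD('l) * V" by (simp only: V_def prod.distrib prod_constant)
  finally have V_low: "inverse V \<le> 2 ^ CARD('l) / \<delta>"
    using pos \<delta> by (simp add: field_simps)
  \<comment> \<open>The index type is nonempty, so the other case of the maximum,
    \<open>2 / \<delta>\<close>, obeys the same bound.\<close>
  have "(2::real) ^ 1 \<le> 2 ^ CARD('l)" by (rule power_increasing) (simp_all add: Suc_leI)
  then have two: "2 / \<delta> \<le> 2 ^ CARD('l) / \<delta>" using \<delta> by (simp add: divide_right_mono)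
  have "(\<Sum>j\<in>A. \<Prod>u\<in>UNIV. inverse \<bar>s j u\<bar>) \<le> real (card A) * inverse V"
    by (rule sum_bounded_above[OF summand])
  also have "\<dots> \<le> max 1 (2 * V / \<delta>) * inverse V"
    using card pos by (intro mult_right_mono) auto
  also have "\<dots> = max (inverse V) (2 / \<delta>)"
    using pos by (simp add: inverse_eq_divide max_divide_distrib_right)
  also have "\<dots> \<le> 2 ^ CARD('l) / \<delta>"
    using V_low two by simp
  finally show ?thesis .
qed

lemma sum_inverse_prod_separated_le:
  fixes s :: "'a \<Rightarrow> 'l::finite \<Rightarrow> real"
  assumes fin: "finite S"
    and le1: "\<And>j u. j \<in> S \<Longrightarrow> \<bar>s j u\<bar> \<le> 1"
    and low: "\<And>j. j \<in> S \<Longrightarrow> c \<le> (\<Prod>u\<in>UNIV. \<bar>s j u\<bar>)"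
    and sep: "\<And>j i. j \<in> S \<Longrightarrow> i \<in> S \<Longrightarrow> j \<noteq> i \<Longrightarrow> \<delta> \<le> (\<Prod>u\<in>UNIV. \<bar>s j u - s i u\<bar>)"
    and \<delta>: "0 < \<delta>" "\<delta> \<le> c"
  shows "(\<Sum>j\<in>S. \<Prod>u\<in>UNIV. inverse \<bar>s j u\<bar>) \<le>
    4 ^ CARD('l) / \<delta> * real ((CARD('l) + nat \<lfloor>log 2 (1 / c)\<rfloor>) choose CARD('l))"
proof -
  define L where "L = nat \<lfloor>log 2 (1 / c)\<rfloor>"
  define k where "k j u = nat \<lfloor>log 2 (1 / \<bar>s j u\<bar>)\<rfloor>" for j u
  \<comment> \<open>The second component records the sign pattern; there are
    \<open>2 ^ CARD('l)\<close> of them.\<close>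
  define cell where "cell j = (k j, {u. s j u < 0})" for j
  have c: "0 < c" using \<delta> by simp
  have pos: "0 < \<bar>s j u\<bar>" if "j \<in> S" for j u
  proof -
    have "(\<Prod>u\<in>UNIV. \<bar>s j u\<bar>) \<noteq> 0" using low[OF that] c by linarith
    then show ?thesis by simp
  qed
  have dyadic: "(1/2) ^ Suc (k j u) < \<bar>s j u\<bar> \<and> \<bar>s j u\<bar> \<le> (1/2) ^ k j u" if "j \<in> S" for j u
    using dyadic_bounds[OF pos[OF that] le1[OF that], of u] unfolding k_def by blast
  have sum_k: "sum (k j) UNIV \<le> L" if "j \<in> S" for j
  proof -
    have "c \<le> (\<Prod>u\<in>UNIV. \<bar>s j u\<bar>)" by (rule low[OF that])
    also have "\<dots> \<le> (\<Prod>u\<in>UNIV. (1/2) ^ k j u)"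
      using dyadic[OF that] by (intro prod_mono) auto
    also have "\<dots> = (1/2) ^ sum (k j) UNIV" by (simp add: power_sum)
    finally have "2 ^ sum (k j) UNIV \<le> 1 / c" using c by (simp add: field_simps)
    then have "2 powr real (sum (k j) UNIV) \<le> 1 / c"
      by (simp only: powr_realpow zero_less_numeral)
    then have "real (sum (k j) UNIV) \<le> log 2 (1 / c)"
      using c by (subst le_log_iff) auto
    then show ?thesis unfolding L_def by linarith
  qed
  let ?K = "{k :: 'l \<Rightarrow> nat. sum k UNIV \<le> L}"
  have K: "finite ?K" "card ?K \<le> (CARD('l) + L) choose CARD('l)"
    using finite_card_functions_sum_le[of "UNIV :: 'l set" L] by simp_all
  have "cell ` S \<subseteq> ?K \<times> Pow UNIV" using sum_k by (auto simp: cell_def)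
  then have "card (cell ` S) \<le> card (?K \<times> Pow (UNIV :: 'l set))"
    using K(1) by (intro card_mono) auto
  also have "\<dots> \<le> ((CARD('l) + L) choose CARD('l)) * 2 ^ CARD('l)"
    using K(2) by (simp add: card_cartesian_product card_Pow del: Pow_UNIV)
  finally have cells: "real (card (cell ` S)) \<le> real ((CARD('l) + L) choose CARD('l)) * 2 ^ CARD('l)"
    by (metis of_nat_le_iff of_nat_mult of_nat_numeral of_nat_power)
  have "(\<Sum>j\<in>S. \<Prod>u\<in>UNIV. inverse \<bar>s j u\<bar>) =
      (\<Sum>y\<in>cell ` S. \<Sum>j\<in>{j \<in> S. cell j = y}. \<Prod>u\<in>UNIV. inverse \<bar>s j u\<bar>)"
    by (rule sum.image_gen[OF fin])
  also have "\<dots> \<le> real (card (cell ` S)) * (2 ^ CARD('l) / \<delta>)"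
  proof (rule sum_bounded_above)
    fix y assume "y \<in> cell ` S"
    show "(\<Sum>j\<in>{j \<in> S. cell j = y}. \<Prod>u\<in>UNIV. inverse \<bar>s j u\<bar>) \<le> 2 ^ CARD('l) / \<delta>"
    proof (rule sum_inverse_prod_cell_le[where k = "fst y"])
      show "(1/2) ^ Suc (fst y u) < \<bar>s j u\<bar> \<and> \<bar>s j u\<bar> \<le> (1/2) ^ fst y u"
        if "j \<in> {j \<in> S. cell j = y}" for j u
        using that dyadic[of j u] by (auto simp: cell_def)
      show "s j u < 0 \<longleftrightarrow> s i u < 0"
        if "j \<in> {j \<in> S. cell j = y}" "i \<in> {j \<in> S. cell j = y}" for j i u
        using that by (auto simp: cell_def)
      \<comment> \<open>The cell bound takes one constant for points and differences;
        \<open>\<delta> \<le> c\<close> permits the smaller one.\<close>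
      show "\<delta> \<le> (\<Prod>u\<in>UNIV. \<bar>s j u\<bar>)" if "j \<in> {j \<in> S. cell j = y}" for j
        using that low[of j] \<delta> by auto
    qed (use sep \<delta> in auto)
  qed
  also have "\<dots> \<le> (real ((CARD('l) + L) choose CARD('l)) * 2 ^ CARD('l)) * (2 ^ CARD('l) / \<delta>)"
    using cells \<delta> by (intro mult_right_mono) auto
  \<comment> \<open>One power of 2 counts sign patterns, the other comes from the bound for a single
    cell.\<close>
  also have "\<dots> = 4 ^ CARD('l) / \<delta> * real ((CARD('l) + L) choose CARD('l))"
    by (simp add: power_mult_distrib[of "2::real" 2, simplified])
  finally show ?thesis unfolding L_def .
qed

section \<open>Integer vectors and their residues\<close>

lemma dist_nearest_int_le: "dist_nearest_int y \<le> \<bar>y - of_int n\<bar>"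
  unfolding dist_nearest_int_def by (rule round_diff_minimal)

lemma int_sup_norm_le_iff: "int_sup_norm j \<le> n \<longleftrightarrow> (\<forall>i. \<bar>j $ i\<bar> \<le> int n)"
  unfolding int_sup_norm_def by (auto simp: nat_le_iff)

lemma finite_int_sup_norm_le: "finite {j :: int ^ 'm. int_sup_norm j \<le> n}"
proof -
  have "vec_nth ` {j :: int ^ 'm. int_sup_norm j \<le> n} \<subseteq> PiE UNIV (\<lambda>_. {- int n..int n})"
    by (auto simp: int_sup_norm_le_iff abs_le_iff minus_le_iff)
  moreover have "finite (PiE (UNIV :: 'm set) (\<lambda>_. {- int n..int n}))"
    by (intro finite_PiE) auto
  ultimately have "finite (vec_nth ` {j :: int ^ 'm. int_sup_norm j \<le> n})"
    by (rule finite_subset)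
  then show ?thesis by (rule finite_imageD) (auto simp: inj_on_def vec_nth_inject)
qed

theorem theorem2p2:
  fixes M :: "real ^ 'm ^ 'l" and \<phi> :: "nat \<Rightarrow> real" and J :: nat
  assumes \<phi>_range: "\<And>n. n \<ge> 1 \<Longrightarrow> 0 < \<phi> n \<and> \<phi> n < 1"
    and \<phi>_noninc: "antimono_on {1..} \<phi>"
    and M_bound: "\<And>j :: int ^ 'm. j \<noteq> 0 \<Longrightarrow>
      (\<Prod>u\<in>UNIV. dist_nearest_int (real_vec j \<bullet> row u M)) \<ge> \<phi> (int_sup_norm j)"
    and J_pos: "J \<ge> 1"
  shows "(\<Sum>j \<in> {j :: int ^ 'm. j \<noteq> 0 \<and> int_sup_norm j \<le> J}.
            \<Prod>u\<in>UNIV. inverse (dist_nearest_int (real_vec j \<bullet> row u M)))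
         \<le> 4 ^ CARD('l) / \<phi> (2 * J)
            * real ((CARD('l) + nat \<lfloor>log 2 (1 / \<phi> J)\<rfloor>) choose CARD('l))"
proof -
  \<comment> \<open>Signed residues are kept because their differences agree modulo 1 with the
    values at \<open>j - i\<close>, which fails for distances when the signs differ.\<close>
  define s where "s j u = real_vec j \<bullet> row u M - of_int (round (real_vec j \<bullet> row u M))"
    for j :: "int ^ 'm" and u :: 'l
  have dist_s: "dist_nearest_int (real_vec j \<bullet> row u M) = \<bar>s j u\<bar>" for j u
    by (simp add: s_def dist_nearest_int_def)
  have bound: "\<phi> n \<le> (\<Prod>u\<in>UNIV. dist_nearest_int (real_vec j \<bullet> row u M))"
    if "j \<noteq> 0" "int_sup_norm j \<le> n" for j :: "int ^ 'm" and n
  proof -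
    \<comment> \<open>Monotonicity of \<open>\<phi>\<close> is given only from 1 on, so norm 0 must
      be excluded first.\<close>
    have "int_sup_norm j \<noteq> 0"
    proof
      assume "int_sup_norm j = 0"
      then have "\<forall>i. \<bar>j $ i\<bar> \<le> int 0" using int_sup_norm_le_iff[of j 0] by simp
      then show False using that(1) by (simp add: vec_eq_iff)
    qed
    then have "\<phi> n \<le> \<phi> (int_sup_norm j)"
      using that(2) by (intro monotone_onD[OF \<phi>_noninc]) auto
    then show ?thesis using M_bound[OF that(1)] by linarith
  qed
  have "(\<Sum>j \<in> {j :: int ^ 'm. j \<noteq> 0 \<and> int_sup_norm j \<le> J}. \<Prod>u\<in>UNIV. inverse \<bar>s j u\<bar>)
      \<le> 4 ^ CARD('l) / \<phi> (2 * J)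
            * real ((CARD('l) + nat \<lfloor>log 2 (1 / \<phi> J)\<rfloor>) choose CARD('l))"
  proof (rule sum_inverse_prod_separated_le)
    show "finite {j :: int ^ 'm. j \<noteq> 0 \<and> int_sup_norm j \<le> J}"
      by (rule finite_subset[OF _ finite_int_sup_norm_le[of J]]) auto
    show "\<bar>s j u\<bar> \<le> 1" for j u
      using of_int_round_abs_le[of "real_vec j \<bullet> row u M"] unfolding s_def by linarith
    show "\<phi> J \<le> (\<Prod>u\<in>UNIV. \<bar>s j u\<bar>)" if "j \<in> {j. j \<noteq> 0 \<and> int_sup_norm j \<le> J}" for j
      using bound[of j J] that by (simp add: dist_s)
    show "\<phi> (2 * J) \<le> (\<Prod>u\<in>UNIV. \<bar>s j u - s i u\<bar>)"
      if ji: "j \<in> {j. j \<noteq> 0 \<and> int_sup_norm j \<le> J}" "i \<in> {j. j \<noteq> 0 \<and> int_sup_norm j \<le> J}" "j \<noteq> i"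
      for j i
    proof -
      have "\<bar>(j - i) $ t\<bar> \<le> int (2 * J)" for t
      proof -
        have "\<bar>j $ t\<bar> \<le> int J" "\<bar>i $ t\<bar> \<le> int J"
          using ji by (auto simp: int_sup_norm_le_iff)
        then show ?thesis by simp
      qed
      then have "int_sup_norm (j - i) \<le> 2 * J" by (simp add: int_sup_norm_le_iff)
      then have "\<phi> (2 * J) \<le> (\<Prod>u\<in>UNIV. dist_nearest_int (real_vec (j - i) \<bullet> row u M))"
        using ji by (intro bound) auto
      \<comment> \<open>Each \<open>s j u - s i u\<close> is the value at \<open>j - i\<close> minus
        some integer, and no integer is closer to that value than the nearest one.\<close>
      also have "\<dots> \<le> (\<Prod>u\<in>UNIV. \<bar>s j u - s i u\<bar>)"
      proof (intro prod_mono conjI)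
        fix u
        have "real_vec (j - i) = real_vec j - real_vec i"
          by (simp add: real_vec_def vec_eq_iff)
        then have "s j u - s i u = real_vec (j - i) \<bullet> row u M
            - of_int (round (real_vec j \<bullet> row u M) - round (real_vec i \<bullet> row u M))"
          by (simp add: s_def inner_diff_left)
        then show "dist_nearest_int (real_vec (j - i) \<bullet> row u M) \<le> \<bar>s j u - s i u\<bar>"
          by (metis dist_nearest_int_le)
      qed (simp add: dist_nearest_int_def)
      finally show ?thesis .
    qed
    show "0 < \<phi> (2 * J)" using \<phi>_range[of "2 * J"] J_pos by simp
    show "\<phi> (2 * J) \<le> \<phi> J" using J_pos by (intro monotone_onD[OF \<phi>_noninc]) auto
  qed
  then show ?thesis by (simp add: dist_s)
qed

end
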